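(* Let $k\ge 2$, and let $D$ be a digraph of order $n$ that has property $S_k$. Then $D$ has at least $kn$ edges, and if $D$ has exactly $kn$ edges then $D$ is isomorphic to some element of $\mathcal A(n,k)$.
   Context: Digraphs are finite and have no loops; between two distinct vertices $x,y$ there may be an edge from $x$ to $y$, an edge from $y$ to $x$, both, or neither (no repeated edges in the same direction). The order of a digraph is its number of vertices. A digraph with at least $k+1$ vertices has property $S_k$ if for every $k$-set $B$ of vertices there is a vertex $u$ such that $B$ is contained in the outneighbourhood of $u$ (that is, there is a directed edge from $u$ to every element of $B$). For $n\ge k+1$, $\mathcal A(n,k)$ is the family of all digraphs on vertex set $[n]=\{1,\dots,n\}$ whose edges are exactly: (i) all $k(k+1)$ directed edges between distinct elements of $[k+1]$ (in both directions); and (ii) for each $i\in[n]$ with $i>k+1$, directed edges to $i$ from exactly $k$ elements of $[k+1]$ (the choice of the $k$ elements may depend arbitrarily on $i$). *)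

theory Defs
  imports "Graph_Theory.Pair_Digraph" "Graph_Theory.Digraph_Isomorphism"
begin

definition out_neighbourhood :: "('a, 'b) pre_digraph \<Rightarrow> 'a \<Rightarrow> 'a set" where
  "out_neighbourhood D u = {v. u \<rightarrow>\<^bsub>D\<^esub> v}"

definition property_S :: "nat \<Rightarrow> ('a, 'b) pre_digraph \<Rightarrow> bool" where
  "property_S k D \<longleftrightarrow>
     card (verts D) \<ge> k + 1 \<and>
     (\<forall>B. B \<subseteq> verts D \<and> finite B \<and> card B = k \<longrightarrow>
        (\<exists>u \<in> verts D. B \<subseteq> out_neighbourhood D u))"

(* N i is the set of the k elements of [k+1] that send an edge to i, for i > k+1. *)
definition family_A :: "nat \<Rightarrow> nat \<Rightarrow> nat pair_pre_digraph set" where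
  "family_A n k =
     {\<lparr> pverts = {1..n},
        parcs = {(i, j). i \<in> {1..k+1} \<and> j \<in> {1..k+1} \<and> i \<noteq> j} \<union>
                {(j, i). i \<in> {1..n} \<and> i > k + 1 \<and> j \<in> N i} \<rparr> | N.
      n \<ge> k + 1 \<and> (\<forall>i \<in> {1..n}. i > k + 1 \<longrightarrow> N i \<subseteq> {1..k+1} \<and> card (N i) = k)}"

end

(*
  For a vertex v with fewer than k in-neighbours, some k-set contains v together with its whole
  in-neighbourhood, and a vertex dominating that set would be an in-neighbour of itself.  So all
  in-degrees are at least k, and kn edges force in-degree exactly k everywhere.

  In that case let v be a vertex and w one of its in-neighbours.  The only vertex that can dominate
  v together with the other in-neighbours is w, so every in-neighbourhood is a complete digraph.
  If u dominates the in-neighbourhood of v, then adding u to it gives a set K of k + 1 vertices,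
  and counting in-degrees shows that K is complete and receives no edge from outside.  Finally a
  vertex x outside K, together with any k - 1 >= 1 vertices of K, is dominated by a vertex of K,
  which forces x to have k in-neighbours in K.
*)

theory Submission
  imports Defs
begin

section \<open>In-degrees, arc counts and relabelled copies\<close>

definition in_neighbourhood :: "('a, 'b) pre_digraph \<Rightarrow> 'a \<Rightarrow> 'a set" where
  "in_neighbourhood D v = {u. u \<rightarrow>\<^bsub>D\<^esub> v}"

lemma (in fin_digraph) card_arcs_eq_sum_in_degree:
  "card (arcs G) = (\<Sum>v\<in>verts G. in_degree G v)"
proof -
  have "arcs G = (\<Union>v\<in>verts G. in_arcs G v)"
    by auto
  then have "card (arcs G) = card (\<Union>v\<in>verts G. in_arcs G v)"
    by simp
  also have "\<dots> = (\<Sum>v\<in>verts G. card (in_arcs G v))"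
    by (rule card_UN_disjoint) auto
  finally show ?thesis
    by (simp add: in_degree_def)
qed

text \<open>Without parallel arcs, an arc into \<open>v\<close> is determined by its tail.\<close>

lemma (in nomulti_digraph) in_degree_eq_card_in_neighbourhood:
  "in_degree G v = card (in_neighbourhood G v)"
proof -
  have "in_neighbourhood G v = tail G ` in_arcs G v"
    by (auto simp: in_neighbourhood_def arcs_ends_conv)
  moreover have "inj_on (tail G) (in_arcs G v)"
    by (rule inj_onI) (auto intro: no_multi_arcs simp: arc_to_ends_def)
  ultimately show ?thesis
    by (simp add: in_degree_def card_image)
qed

text \<open>Passes from an arbitrary arc type to pairs, the form in which \<open>family_A\<close> is
  given. Replacing an arc by the pair of its relabelled ends loses nothing, since parallel arcs are
  absent and \<open>f\<close> is injective on vertices.\<close>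

lemma (in nomulti_digraph) digraph_iso_inj_image:
  assumes "inj_on f (verts G)"
  shows "digraph_iso G (with_proj \<lparr>pverts = f ` verts G, parcs = map_prod f f ` arcs_ends G\<rparr>)"
proof -
  define h where "h = \<lparr>iso_verts = f, iso_arcs = (\<lambda>a. (f (tail G a), f (head G a))),
    iso_head = snd, iso_tail = fst\<rparr>"
  have "inj_on (\<lambda>a. (f (tail G a), f (head G a))) (arcs G)"
    using assms by (intro inj_onI no_multi_arcs) (auto simp: arc_to_ends_def dest: inj_onD)
  then have "digraph_isomorphism h"
    using assms by (auto simp: digraph_isomorphism_def h_def wf_digraph)
  moreover have "with_proj \<lparr>pverts = f ` verts G, parcs = map_prod f f ` arcs_ends G\<rparr> = app_iso h G"
    by (simp add: app_iso_def with_proj_def h_def arcs_ends_conv image_image)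
  ultimately show ?thesis
    unfolding digraph_iso_def by blast
qed

section \<open>Property S and in-neighbourhoods\<close>

text \<open>A smaller set extends to a set of exactly \<open>k\<close> vertices, as there are at
  least \<open>k + 1\<close> of them. The result is phrased with in-neighbourhoods so that the
  absence of loops can refute it directly.\<close>

lemma property_S_card_le:
  assumes "property_S k D" "B \<subseteq> verts D" "finite (verts D)" "card B \<le> k"
  obtains u where "u \<in> verts D" "\<And>b. b \<in> B \<Longrightarrow> u \<in> in_neighbourhood D b"
proof -
  have "k \<le> card (verts D)"
    using assms(1) by (simp add: property_S_def)
  then obtain B' where "B \<subseteq> B'" "B' \<subseteq> verts D" "card B' = k"
    using exists_subset_between assms by metis
  moreover have "finite B'"
    using \<open>B' \<subseteq> verts D\<close> assms(3) by (rule finite_subset)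
  ultimately obtain u where "u \<in> verts D" "B' \<subseteq> out_neighbourhood D u"
    using assms(1) unfolding property_S_def by blast
  with \<open>B \<subseteq> B'\<close> show thesis
    by (intro that) (auto simp: out_neighbourhood_def in_neighbourhood_def)
qed

context digraph
begin

lemma in_neighbourhood_subset_verts: "in_neighbourhood G v \<subseteq> verts G"
  by (auto simp: in_neighbourhood_def dest: adj_in_verts)

lemma finite_in_neighbourhood [simp]: "finite (in_neighbourhood G v)"
  using in_neighbourhood_subset_verts finite_verts by (rule finite_subset)

lemma not_in_own_in_neighbourhood [simp]: "v \<notin> in_neighbourhood G v"
  by (auto simp: in_neighbourhood_def dest: adj_not_same)

lemma property_S_in_neighbourhood_card_ge:
  assumes "property_S k G" "v \<in> verts G"
  shows "k \<le> card (in_neighbourhood G v)"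
proof (rule ccontr)
  assume "\<not> ?thesis"
  then have "card (insert v (in_neighbourhood G v)) \<le> k"
    by simp
  moreover have "insert v (in_neighbourhood G v) \<subseteq> verts G"
    using assms(2) in_neighbourhood_subset_verts by simp
  ultimately obtain u where
    "\<And>b. b \<in> insert v (in_neighbourhood G v) \<Longrightarrow> u \<in> in_neighbourhood G b"
    using property_S_card_le[OF assms(1)] finite_verts by metis
  \<comment> \<open>Taking \<open>b = v\<close> puts \<open>u\<close> into the in-neighbourhood of
    \<open>v\<close>, hence into the dominated set; then \<open>b = u\<close> is allowed.\<close>
  then have "u \<in> in_neighbourhood G u"
    by blast
  then show False
    by simp
qed

lemma property_S_card_arcs_ge:
  assumes "property_S k G"
  shows "k * card (verts G) \<le> card (arcs G)"
  using sum_bounded_below[of "verts G" k "in_degree G"]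
    property_S_in_neighbourhood_card_ge[OF assms]
  by (simp add: card_arcs_eq_sum_in_degree in_degree_eq_card_in_neighbourhood mult.commute)

lemma property_S_card_arcs_eq_imp_regular:
  assumes "property_S k G" "card (arcs G) = k * card (verts G)" "v \<in> verts G"
  shows "card (in_neighbourhood G v) = k"
proof (rule ccontr)
  assume "card (in_neighbourhood G v) \<noteq> k"
  then have "k < card (in_neighbourhood G v)"
    using property_S_in_neighbourhood_card_ge[OF assms(1,3)] by simp
  then have "(\<Sum>v\<in>verts G. k) < (\<Sum>v\<in>verts G. card (in_neighbourhood G v))"
    using assms property_S_in_neighbourhood_card_ge[OF assms(1)]
    by (intro sum_strict_mono_ex1) auto
  then show False
    using assms(2)
    by (simp add: card_arcs_eq_sum_in_degree in_degree_eq_card_in_neighbourhood mult.commute)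
qed

lemma property_S_regular_in_neighbours_adjacent:
  assumes "property_S k G" "card (in_neighbourhood G v) = k" "v \<in> verts G"
    and "w \<in> in_neighbourhood G v" "w' \<in> in_neighbourhood G v" "w \<noteq> w'"
  shows "w \<in> in_neighbourhood G w'"
proof -
  let ?B = "insert v (in_neighbourhood G v - {w})"
  have "card ?B \<le> k"
    using assms(2,4) card_Suc_Diff1[of "in_neighbourhood G v" w] by simp
  moreover have "?B \<subseteq> verts G"
    using assms(3) in_neighbourhood_subset_verts by auto
  ultimately obtain u where u: "\<And>b. b \<in> ?B \<Longrightarrow> u \<in> in_neighbourhood G b"
    using property_S_card_le[OF assms(1)] finite_verts by metis
  then have "u \<in> in_neighbourhood G v"
    by simp
  \<comment> \<open>A member of \<open>?B\<close> would dominate itself. The only in-neighbour of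
    \<open>v\<close> outside \<open>?B\<close> is \<open>w\<close>.\<close>
  moreover have "u \<notin> ?B"
    using u not_in_own_in_neighbourhood by blast
  ultimately have "u = w"
    by auto
  then show ?thesis
    using u assms(5,6) by auto
qed

text \<open>\<open>K\<close> is the core that will receive the labels \<open>1\<close> to
  \<open>k + 1\<close>.\<close>

lemma property_S_regular_structure:
  assumes S: "property_S k G" and "2 \<le> k"
    and reg: "\<And>v. v \<in> verts G \<Longrightarrow> card (in_neighbourhood G v) = k"
  obtains K where "K \<subseteq> verts G" "card K = k + 1"
    "\<And>v. v \<in> K \<Longrightarrow> in_neighbourhood G v = K - {v}"
    "\<And>v. v \<in> verts G - K \<Longrightarrow> in_neighbourhood G v \<subseteq> K"
proof -
  let ?N = "in_neighbourhood G"
  note adj = property_S_regular_in_neighbours_adjacent[OF S reg]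
  obtain v where v: "v \<in> verts G"
    using S unfolding property_S_def by fastforce
  obtain u where u: "u \<in> verts G" "\<And>w. w \<in> ?N v \<Longrightarrow> u \<in> ?N w"
    using property_S_card_le[OF S in_neighbourhood_subset_verts[of v] finite_verts] reg[OF v] by auto
  define K where "K = insert u (?N v)"
  have "u \<notin> ?N v"
    using u(2) not_in_own_in_neighbourhood by blast
  then have card_K: "card K = k + 1"
    by (simp add: K_def reg[OF v])
  have K_verts: "K \<subseteq> verts G"
    using u(1) in_neighbourhood_subset_verts by (simp add: K_def)
  have fin_K: "finite K"
    by (simp add: K_def)
  \<comment> \<open>Both sides have \<open>k\<close> elements, so one inclusion suffices.\<close>
  have eqI: "?N w = K - {w}" if "w \<in> K" "K - {w} \<subseteq> ?N w" for w
  proof (rule sym, rule card_subset_eq)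
    show "card (K - {w}) = card (?N w)"
      using that(1) K_verts reg card_K fin_K by auto
  qed (use that in auto)
  have N_old: "?N w = K - {w}" if "w \<in> ?N v" for w
    using that u(2) adj[OF v v] by (intro eqI) (auto simp: K_def)
  have N_u: "?N u = K - {u}"
  proof (rule eqI)
    show "K - {u} \<subseteq> ?N u"
    proof
      fix w assume w: "w \<in> K - {u}"
      then have "w \<in> ?N v"
        by (auto simp: K_def)
      \<comment> \<open>Here \<open>k >= 2\<close> supplies a second in-neighbour \<open>w'\<close>
        of \<open>v\<close>. Both \<open>w\<close> and \<open>u\<close> are in-neighbours of
        \<open>w'\<close>, so adjacency inside the in-neighbourhood of \<open>w'\<close> yields the
        arc from \<open>w\<close> to \<open>u\<close>.\<close>
      have "card (?N v - {w}) \<noteq> 0"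
        using \<open>w \<in> ?N v\<close> reg[OF v] \<open>2 \<le> k\<close> by simp
      then have "?N v - {w} \<noteq> {}"
        by (metis card.empty)
      then obtain w' where w': "w' \<in> ?N v" "w' \<noteq> w"
        by blast
      have "w' \<in> verts G"
        using w'(1) in_neighbourhood_subset_verts by blast
      moreover have "w \<in> ?N w'" "u \<in> ?N w'"
        using w w' u(2) N_old by auto
      ultimately show "w \<in> ?N u"
        using adj w by blast
    qed
  qed (simp add: K_def)
  have N_K: "?N w = K - {w}" if "w \<in> K" for w
    using that N_old N_u by (auto simp: K_def)
  have "?N x \<subseteq> K" if x: "x \<in> verts G - K" for x
  proof (rule ccontr)
    assume "\<not> ?N x \<subseteq> K"
    then have "?N x \<inter> K \<subset> ?N x"
      by blast
    then have "card (?N x \<inter> K) < k"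
      using psubset_card_mono[OF finite_in_neighbourhood] reg x by (metis DiffD1)
    \<comment> \<open>\<open>B\<close> has room for all in-neighbours of \<open>x\<close> in
      \<open>K\<close>, since there are at most \<open>k - 1\<close> of them; with \<open>x\<close>
      it forms a \<open>k\<close>-set.\<close>
    then have "\<exists>B. ?N x \<inter> K \<subseteq> B \<and> B \<subseteq> K \<and> card B = k - 1"
      using card_K fin_K by (intro exists_subset_between) auto
    then obtain B where B: "?N x \<inter> K \<subseteq> B" "B \<subseteq> K" "card B = k - 1"
      by blast
    have fin_B: "finite B"
      using B(2) fin_K by (rule finite_subset)
    have "card (insert x B) \<le> k"
      using B x fin_B \<open>2 \<le> k\<close> by (simp add: card_insert_if)
    moreover have "insert x B \<subseteq> verts G"
      using x B(2) K_verts by blast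
    ultimately obtain z where z: "\<And>b. b \<in> insert x B \<Longrightarrow> z \<in> ?N b"
      using property_S_card_le[OF S] finite_verts by metis
    have "B \<noteq> {}"
      using B(3) \<open>2 \<le> k\<close> by auto
    then obtain b where "b \<in> B"
      by blast
    \<comment> \<open>Arcs into \<open>b\<close> come only from \<open>K\<close>. So
      \<open>z\<close> is an in-neighbour of \<open>x\<close> in \<open>K\<close>, thus lies in
      \<open>B\<close>, and would have to dominate itself.\<close>
    then have "z \<in> K"
      using z[of b] B(2) N_K[of b] by auto
    then have "z \<in> B"
      using z[of x] B(1) by blast
    then show False
      using z not_in_own_in_neighbourhood by blast
  qed
  with K_verts card_K N_K show thesis
    by (rule that)
qed

section \<open>Isomorphism with a member of the family A(n,k)\<close>

lemma digraph_iso_family_A: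
  assumes "K \<subseteq> verts G" "card K = k + 1"
    and N_K: "\<And>v. v \<in> K \<Longrightarrow> in_neighbourhood G v = K - {v}"
    and N_out: "\<And>v. v \<in> verts G - K \<Longrightarrow> in_neighbourhood G v \<subseteq> K"
    and card_N_out: "\<And>v. v \<in> verts G - K \<Longrightarrow> card (in_neighbourhood G v) = k"
  shows "\<exists>H \<in> family_A (card (verts G)) k. digraph_iso G (with_proj H)"
proof -
  let ?n = "card (verts G)"
  have fin_K: "finite K"
    using assms(1) finite_verts by (rule finite_subset)
  have n: "k + 1 \<le> ?n"
    using card_mono[OF finite_verts assms(1)] assms(2) by simp
  \<comment> \<open>The labelling is glued from two arbitrary bijections: \<open>K\<close> goes to
    the core labels, the remaining vertices to the labels from \<open>k + 2\<close> on.\<close>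
  obtain g where g: "bij_betw g K {1..k+1}"
    using finite_same_card_bij[of K "{1..k+1}"] fin_K assms(2) by auto
  obtain h where h: "bij_betw h (verts G - K) {k+2..?n}"
    using finite_same_card_bij[of "verts G - K" "{k+2..?n}"] assms(1,2) fin_K n
    by (auto simp: card_Diff_subset)
  define f where "f = (\<lambda>x. if x \<in> K then g x else h x)"
  have "bij_betw f (K \<union> (verts G - K)) ({1..k+1} \<union> {k+2..?n})"
    unfolding f_def using g h by (rule bij_betw_disjoint_Un) auto
  moreover have "K \<union> (verts G - K) = verts G"
    using assms(1) by blast
  moreover have "{1..k+1} \<union> {k+2..?n} = {1..?n}"
    using n by auto
  ultimately have f: "bij_betw f (verts G) {1..?n}"
    by simp
  have f_inj: "inj_on f (verts G)" and f_image: "f ` verts G = {1..?n}"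
    using f by (auto simp: bij_betw_def)
  have f_K: "f ` K = {1..k+1}"
    using g by (auto simp: f_def bij_betw_def)
  have f_out: "f ` (verts G - K) = {k+2..?n}"
    using h by (auto simp: f_def bij_betw_def)
  \<comment> \<open>The choice function of \<open>family_A\<close> takes labels, so
    \<open>inv_into\<close> first recovers the vertex carrying the label \<open>i\<close>.\<close>
  define N where "N = (\<lambda>i. f ` in_neighbourhood G (inv_into (verts G) f i))"
  have N_f: "N (f v) = f ` in_neighbourhood G v" if "v \<in> verts G" for v
    using that f_inj by (simp add: N_def)
  define H where "H = \<lparr>pverts = f ` verts G, parcs = map_prod f f ` arcs_ends G\<rparr>"
  have arcs_out: "N i \<subseteq> {1..k+1} \<and> card (N i) = k" if "i \<in> {1..?n}" "i > k + 1" for i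
  proof -
    have "i \<in> f ` (verts G - K)"
      using that f_out by auto
    then obtain v where v: "v \<in> verts G - K" "i = f v"
      by blast
    have "inj_on f (in_neighbourhood G v)"
      using f_inj in_neighbourhood_subset_verts by (rule inj_on_subset)
    then show ?thesis
      using v N_f[of v] N_out[of v] card_N_out[of v] f_K by (auto simp: card_image)
  qed
  have "map_prod f f ` arcs_ends G =
      {(i, j). i \<in> {1..k+1} \<and> j \<in> {1..k+1} \<and> i \<noteq> j} \<union>
      {(j, i). i \<in> {1..?n} \<and> i > k + 1 \<and> j \<in> N i}" (is "?L = ?A \<union> ?B")
  proof -
    \<comment> \<open>The arcs are split by whether the head lies in \<open>K\<close>; the two
      classes map to the clauses (i) and (ii) of the family.\<close>
    have "arcs_ends G = {(u, v). v \<in> K \<and> u \<in> K - {v}} \<union>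
        {(u, v). v \<in> verts G - K \<and> u \<in> in_neighbourhood G v}" (is "_ = ?A' \<union> ?B'")
      using N_K by (auto simp: in_neighbourhood_def dest: adj_in_verts)
    moreover have "map_prod f f ` ?A' = ?A"
    proof -
      \<comment> \<open>Injectivity is what turns distinct ends into the condition
        \<open>i \<noteq> j\<close> on labels.\<close>
      have "f u \<noteq> f v" if "u \<in> K" "v \<in> K" "u \<noteq> v" for u v
        using that assms(1) f_inj by (meson inj_onD subsetD)
      then show ?thesis
        unfolding f_K[symmetric] by (fastforce simp: image_iff)
    qed
    moreover have "map_prod f f ` ?B' = ?B"
    proof -
      have "?B = {(j, i). i \<in> f ` (verts G - K) \<and> j \<in> N i}"
        unfolding f_out by auto
      also have "\<dots> = map_prod f f ` ?B'"
        using N_f by (fastforce simp: image_iff)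
      finally show ?thesis ..
    qed
    ultimately show ?thesis
      by (simp add: image_Un)
  qed
  then have "H \<in> family_A ?n k"
    unfolding family_A_def H_def f_image using n arcs_out by blast
  moreover have "digraph_iso G (with_proj H)"
    unfolding H_def using f_inj by (rule digraph_iso_inj_image)
  ultimately show ?thesis
    by blast
qed

end

theorem lemma6:
  fixes D :: "('a, 'b) pre_digraph" and n k :: nat
  assumes "k \<ge> 2"
    and "digraph D"
    and "card (verts D) = n"
    and "property_S k D"
  shows "card (arcs D) \<ge> k * n \<and>
    (card (arcs D) = k * n \<longrightarrow> (\<exists>H \<in> family_A n k. digraph_iso D (with_proj H)))"
proof (intro conjI impI)
  interpret digraph D
    by fact
  show "k * n \<le> card (arcs D)"
    using property_S_card_arcs_ge[OF assms(4)] assms(3) by simp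
  assume "card (arcs D) = k * n"
  then have reg: "card (in_neighbourhood D v) = k" if "v \<in> verts D" for v
    using property_S_card_arcs_eq_imp_regular that assms(3,4) by blast
  obtain K where "K \<subseteq> verts D" "card K = k + 1"
    "\<And>v. v \<in> K \<Longrightarrow> in_neighbourhood D v = K - {v}"
    "\<And>v. v \<in> verts D - K \<Longrightarrow> in_neighbourhood D v \<subseteq> K"
    using property_S_regular_structure[OF assms(4,1) reg] by blast
  then show "\<exists>H \<in> family_A n k. digraph_iso D (with_proj H)"
    using digraph_iso_family_A reg unfolding assms(3)[symmetric] by blast
qed

end
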